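(* Let $q \geq 1$ be an integer. For integers $0 \leq i \leq q(q+1)$ let $a_i = \left\lfloor \frac{i^2}{2q(q+1)} \right\rfloor$, and let $w = w[1..q(q+1)]$ be the binary word of length $q(q+1)$ defined by $w[i] = a_i - a_{i-1}$ for $1 \leq i \leq q(q+1)$. Then $w$ contains no abelian square $xx'$ with $|x| = |x'| \geq \sqrt{2q(q+1)}$.
   Context: A finite word is an abelian square of order $k$ if it is of the form $xx'$ with $|x| = |x'| = k$ and $x'$ a permutation (rearrangement of the letters) of $x$. A word contains an abelian square if some contiguous block (factor) of it is an abelian square. Here $|x|$ is the length of $x$. For $1 \leq i \leq q(q+1)$ one has $a_i - a_{i-1} \in \{0,1\}$, so $w$ is indeed a word over the alphabet $\{0,1\}$. *)

theory Defs
  imports Complex_Main "HOL-Library.Multiset" "HOL-Library.Sublist"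
begin

definition abelian_square :: "nat \<Rightarrow> 'a list \<Rightarrow> bool" where
  "abelian_square k u \<longleftrightarrow>
     (\<exists>x x'. u = x @ x' \<and> length x = k \<and> length x' = k \<and> mset x' = mset x)"

definition contains_abelian_square :: "nat \<Rightarrow> 'a list \<Rightarrow> bool" where
  "contains_abelian_square k w \<longleftrightarrow> (\<exists>u. sublist u w \<and> abelian_square k u)"

definition a_seq :: "nat \<Rightarrow> nat \<Rightarrow> int" where
  "a_seq q i = \<lfloor>(real i)\<^sup>2 / (2 * real q * (real q + 1))\<rfloor>"

(* The letter w[i], 1 <= i <= q(q+1), is the list element at position i - 1. *)
definition w_word :: "nat \<Rightarrow> int list" where
  "w_word q = map (\<lambda>i. a_seq q i - a_seq q (i - 1)) [1..<Suc (q * (q + 1))]"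

lemma length_w_word: "length (w_word q) = q * (q + 1)"
  by (simp add: w_word_def del: upt_Suc)

lemma w_word_nth:
  assumes "1 \<le> i" "i \<le> q * (q + 1)"
  shows "w_word q ! (i - 1) = a_seq q i - a_seq q (i - 1)"
proof -
  have "i - 1 < length [1..<Suc (q * (q + 1))]" "[1..<Suc (q * (q + 1))] ! (i - 1) = i"
    using assms by (auto simp: nth_upt simp del: upt_Suc)
  then show ?thesis unfolding w_word_def by (simp only: nth_map)
qed

lemma w_word_binary:
  assumes "q \<ge> 1"
  shows "set (w_word q) \<subseteq> {0, 1}"
proof
  fix c assume "c \<in> set (w_word q)"
  then obtain i where i: "1 \<le> i" "i \<le> q * (q + 1)" and c: "c = a_seq q i - a_seq q (i - 1)"
    by (auto simp: w_word_def)
  define D where "D = 2 * real q * (real q + 1)"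
  have D: "D > 0" using assms by (simp add: D_def)
  have "real i \<le> real (q * (q + 1))" using i(2) by (simp only: of_nat_le_iff)
  then have iD: "2 * real i \<le> D" by (simp add: D_def algebra_simps)
  obtain j where j: "i = Suc j" using i(1) by (cases i) auto
  have sq: "(real i)\<^sup>2 = (real j)\<^sup>2 + (2 * real i - 1)"
    by (simp add: j power2_eq_square algebra_simps)
  have "(real i)\<^sup>2 / D = (real j)\<^sup>2 / D + (2 * real i - 1) / D"
    by (simp add: sq add_divide_distrib)
  moreover have "0 \<le> (2 * real i - 1) / D" using D i(1) by simp
  moreover have "(2 * real i - 1) / D < 1" using D iD by simp
  ultimately have "0 \<le> a_seq q i - a_seq q j \<and> a_seq q i - a_seq q j < 2"
    unfolding a_seq_def D_def[symmetric] by linarith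
  then show "c \<in> {0, 1}" using c j by auto
qed

end

theory Submission
  imports Defs
begin

text \<open>
  Put \<open>D = 2 q (q + 1)\<close>.  The letters of the word are the increments of \<open>a_seq q\<close>, so the letter sum
  of a factor is a difference of two values of \<open>a_seq q\<close>.  The two halves of an abelian square have
  equal letter sums; if the square starts after \<open>m\<close> letters and has order \<open>k\<close>, the second
  difference of \<open>a_seq q\<close> at \<open>m\<close>, \<open>m + k\<close>, \<open>m + 2 k\<close> therefore vanishes.  The corresponding second
  difference of \<open>i\<^sup>2 / D\<close> is \<open>2 k\<^sup>2 / D\<close> whatever \<open>m\<close> is, and rounding down lowers a second
  difference by strictly less than \<open>2\<close>.  Hence \<open>k\<^sup>2 < D\<close>.
\<close>

lemma sum_list_take_w_word:
  assumes "m \<le> q * (q + 1)"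
  shows "sum_list (take m (w_word q)) = a_seq q m"
proof -
  have "take m (w_word q) = map (\<lambda>i. a_seq q i - a_seq q (i - 1)) [1..<Suc m]"
    using assms by (simp add: w_word_def take_map del: upt_Suc)
  moreover have "sum_list (map (\<lambda>i. a_seq q i - a_seq q (i - 1)) [1..<Suc m]) = a_seq q m"
    by (induction m) (simp_all add: a_seq_def)
  ultimately show ?thesis by simp
qed

text \<open>
  Rearranging letters preserves their sum.  Passing to sums loses nothing for this word: over the
  letters \<open>0\<close> and \<open>1\<close>, two words of equal length and equal sum are rearrangements of each other.
\<close>

lemma abelian_square_second_difference:
  assumes "contains_abelian_square k (w_word q)"
  obtains m where "a_seq q (m + 2 * k) + a_seq q m = 2 * a_seq q (m + k)"
proof -
  from assms obtain ps x x' ss where w: "w_word q = ps @ x @ x' @ ss"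
    and len: "length x = k" "length x' = k" and perm: "mset x' = mset x"
    unfolding contains_abelian_square_def abelian_square_def sublist_def by auto
  define m where "m = length ps"
  have bound: "m + 2 * k \<le> q * (q + 1)"
    using arg_cong[OF w, of length] len by (simp add: length_w_word m_def)
  have "sum_list ps = a_seq q m"
    using sum_list_take_w_word[of m q] bound by (simp add: w m_def)
  moreover have "sum_list ps + sum_list x = a_seq q (m + k)"
    using sum_list_take_w_word[of "m + k" q] bound len by (simp add: w m_def)
  moreover have "sum_list ps + sum_list x + sum_list x' = a_seq q (m + 2 * k)"
    using sum_list_take_w_word[of "m + 2 * k" q] bound len by (simp add: w m_def add.assoc)
  moreover have "sum_list x' = sum_list x"
    using perm by (metis sum_mset_sum_list)
  ultimately show thesis by (intro that[of m]) linarith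
qed

text \<open>
  Each of the two outer floors loses less than \<open>1\<close>, while rounding down the subtracted middle
  term can only raise the second difference.
\<close>

lemma second_difference_floor_pos:
  fixes x y z :: real
  assumes "x + z - 2 * y \<ge> 2"
  shows "\<lfloor>x\<rfloor> + \<lfloor>z\<rfloor> > 2 * \<lfloor>y\<rfloor>"
  using assms by linarith

theorem theorem1:
  fixes q :: nat
  assumes "q \<ge> 1"
  shows "\<not> (\<exists>k. real k \<ge> sqrt (2 * real q * (real q + 1)) \<and> contains_abelian_square k (w_word q))"
proof
  assume "\<exists>k. real k \<ge> sqrt (2 * real q * (real q + 1)) \<and> contains_abelian_square k (w_word q)"
  then obtain k where k: "sqrt (2 * real q * (real q + 1)) \<le> real k"
    and sq: "contains_abelian_square k (w_word q)" by blast
  define D where "D = 2 * real q * (real q + 1)"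
  have D: "D > 0" using assms by (simp add: D_def)
  have "D \<le> (real k)\<^sup>2" using k unfolding D_def by (rule sqrt_le_D)
  then have "2 \<le> 2 * (real k)\<^sup>2 / D" using D by (simp add: field_simps)
  moreover obtain m where m: "a_seq q (m + 2 * k) + a_seq q m = 2 * a_seq q (m + k)"
    using sq by (rule abelian_square_second_difference)
  moreover have "(real (m + 2 * k))\<^sup>2 / D + (real m)\<^sup>2 / D - 2 * ((real (m + k))\<^sup>2 / D)
      = 2 * (real k)\<^sup>2 / D"
    using D by (simp add: field_simps power2_eq_square)
  ultimately have "2 * a_seq q (m + k) < a_seq q (m + 2 * k) + a_seq q m"
    unfolding a_seq_def D_def[symmetric] by (intro second_difference_floor_pos) linarith
  then show False using m by linarith
qed

end
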